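(* (1) For $[N]\in T^o$, $X_{[N]}$ is smooth; in particular $i(T^o)\subset S^o$. (2) For $[N]\in D^o_T$, $\mathrm{Sing}(X_{[N]})$ consists of nodes; in particular $i(D^o_T)\subset D^o$. (3) The Zariski closed subset $T\setminus(T^o\cup D^o_T)$ has codimension at least $2$ in $T$.
   Context: Use coordinates $x_1,\dots,x_6$ on $\mathbf P^5$. For a rank-3 matrix $N=(n_{ij})=(\mathbf n_1,\dots,\mathbf n_6)\in M_{3,6}(\mathbf C)$ let $\Delta_{ijk}(N)=\det(\mathbf n_i,\mathbf n_j,\mathbf n_k)$ and $X_{[N]}=\{[x]\in\mathbf P^5:\sum_{k=1}^6x_k^2\mathbf n_k=\mathbf 0\}$. Let $T=\mathrm{Gr}(3,\mathbf C^6)=GL_3(\mathbf C)\backslash\{N:\mathrm{rk}N=3\}$, $T_{ijk}=\{[N]:\Delta_{ijk}(N)=0\}$, $T^o=T\setminus\bigcup_{i<j<k}T_{ijk}$, $T^o_{ijk}=T_{ijk}\setminus\bigcup_{\{l,m,n\}\ne\{i,j,k\}}T_{lmn}$, $D^o_T=\bigcup_{i<j<k}T^o_{ijk}$. Let $V$ be the space of quadratic forms spanned by the monomials $x_ix_j$ with $i,j\le3$ and $x_ix_j$ with $i,j\ge4$, $S=\mathrm{Gr}(3,V)$, and $i:T\to S$, $[N]\mapsto$ the span of $\sum_j n_{kj}x_j^2$, $k=1,2,3$; for $s\in S$, $X_s\subset\mathbf P^5$ is the common zero scheme of the forms in $s$, so $X_{i([N])}=X_{[N]}$. With $\pi:\mathcal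 X\to S$ the family of the $X_s$: $S^*=\{s:\pi$ flat along $X_s\}$, $S^o=\{s\in S^*:X_s$ smooth$\}$, $D^o=\{s\in S^*\setminus S^o:\mathrm{Sing}X_s$ consists of nodes$\}$. *)

theory Defs
  imports "HOL-Analysis.Analysis" "HOL-Library.Extended_Nat"
begin

type_synonym mat36 = "complex^6^3"

definition rank3 :: "mat36 \<Rightarrow> bool" where
  "rank3 N \<longleftrightarrow> (\<forall>c::complex^3. (\<forall>j. (\<Sum>k\<in>UNIV. c$k * N$k$j) = 0) \<longrightarrow> c = 0)"

definition Delta :: "mat36 \<Rightarrow> 6 \<Rightarrow> 6 \<Rightarrow> 6 \<Rightarrow> complex" where
  "Delta N i j k = det (\<chi> r s::3. N $ r $ (if s = 1 then i else if s = 2 then j else k))"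

definition T_o :: "(mat36) set" where
  "T_o = {N. rank3 N \<and> (\<forall>i j k. i < j \<and> j < k \<longrightarrow> Delta N i j k \<noteq> 0)}"

definition T_o_ijk :: "6 \<Rightarrow> 6 \<Rightarrow> 6 \<Rightarrow> (mat36) set" where
  "T_o_ijk i j k = {N. rank3 N \<and> Delta N i j k = 0 \<and>
      (\<forall>l m n. l < m \<and> m < n \<and> (l, m, n) \<noteq> (i, j, k) \<longrightarrow> Delta N l m n \<noteq> 0)}"

definition D_o_T :: "(mat36) set" where
  "D_o_T = (\<Union>{T_o_ijk i j k | i j k. i < j \<and> j < k})"

definition qf :: "complex^6^6 \<Rightarrow> complex^6 \<Rightarrow> complex" where
  "qf A x = (\<Sum>i\<in>UNIV. \<Sum>j\<in>UNIV. A$i$j * x$i * x$j)"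

definition bqf :: "complex^6^6 \<Rightarrow> complex^6 \<Rightarrow> complex^6 \<Rightarrow> complex" where
  "bqf A x y = (\<Sum>i\<in>UNIV. \<Sum>j\<in>UNIV. A$i$j * (x$i * y$j + y$i * x$j))"

definition grad :: "complex^6^6 \<Rightarrow> complex^6 \<Rightarrow> complex^6" where
  "grad A x = (\<chi> i. \<Sum>j\<in>UNIV. (A$i$j + A$j$i) * x$j)"

text \<open>Points of X_Q, represented by nonzero vectors of the affine cone
  (all notions below are invariant under rescaling x).\<close>
definition cone_pts :: "(3 \<Rightarrow> complex^6^6) \<Rightarrow> (complex^6) set" where
  "cone_pts Q = {x. x \<noteq> 0 \<and> (\<forall>k. qf (Q k) x = 0)}"

definition jac_rel :: "(3 \<Rightarrow> complex^6^6) \<Rightarrow> complex^6 \<Rightarrow> (complex^3) set" where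
  "jac_rel Q x = {c. (\<forall>i. (\<Sum>k\<in>UNIV. c$k * grad (Q k) x $ i) = 0)}"

text \<open>Jacobian criterion: X_Q is smooth at x iff the Jacobian matrix of the three
  defining forms has rank 3 at x.\<close>
definition smooth_at :: "(3 \<Rightarrow> complex^6^6) \<Rightarrow> complex^6 \<Rightarrow> bool" where
  "smooth_at Q x \<longleftrightarrow> jac_rel Q x = {0}"

definition smooth_ci :: "(3 \<Rightarrow> complex^6^6) \<Rightarrow> bool" where
  "smooth_ci Q \<longleftrightarrow> (\<forall>x\<in>cone_pts Q. smooth_at Q x)"

definition sing_pts :: "(3 \<Rightarrow> complex^6^6) \<Rightarrow> (complex^6) set" where
  "sing_pts Q = {x\<in>cone_pts Q. \<not> smooth_at Q x}"

text \<open>Node (ordinary double point): the Jacobian has rank exactly 2 at x, so the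
  relations are spanned by one nonzero c; then locally X is a hypersurface in the
  smooth threefold cut out by two of the forms, with local equation the form
  H = sum c_k Q_k, and x is a node iff the Hessian of H restricted to the Zariski
  tangent space W (of the cone) is nondegenerate modulo the line through x, i.e.
  the radical of the bilinear form of H on W is exactly span{x}.\<close>
definition node_at :: "(3 \<Rightarrow> complex^6^6) \<Rightarrow> complex^6 \<Rightarrow> bool" where
  "node_at Q x \<longleftrightarrow> x \<in> cone_pts Q \<and>
     (\<exists>c. c \<noteq> 0 \<and> c \<in> jac_rel Q x \<and>
        (\<forall>d\<in>jac_rel Q x. \<exists>t. d = t *s c) \<and>
        (let H = (\<chi> i j. \<Sum>k\<in>UNIV. c$k * Q k $ i $ j);
             W = {v. \<forall>k. (\<Sum>i\<in>UNIV. grad (Q k) x $ i * v $ i) = 0}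
         in \<forall>v\<in>W. (\<forall>w\<in>W. bqf H v w = 0) \<longrightarrow> (\<exists>t. v = t *s x)))"

definition QN :: "mat36 \<Rightarrow> 3 \<Rightarrow> complex^6^6" where
  "QN N k = (\<chi> i j. if i = j then N$k$i else 0)"

inductive_set poly_fun :: "(mat36 \<Rightarrow> complex) set" where
  pf_const: "(\<lambda>_. c) \<in> poly_fun"
| pf_var: "(\<lambda>N. N$r$s) \<in> poly_fun"
| pf_add: "f \<in> poly_fun \<Longrightarrow> g \<in> poly_fun \<Longrightarrow> (\<lambda>N. f N + g N) \<in> poly_fun"
| pf_mult: "f \<in> poly_fun \<Longrightarrow> g \<in> poly_fun \<Longrightarrow> (\<lambda>N. f N * g N) \<in> poly_fun"

definition zclosed :: "(mat36) set \<Rightarrow> bool" where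
  "zclosed Z \<longleftrightarrow> (\<exists>F\<subseteq>poly_fun. Z = {N. \<forall>f\<in>F. f N = 0})"

definition zclosure :: "(mat36) set \<Rightarrow> (mat36) set" where
  "zclosure S = \<Inter>{Z. zclosed Z \<and> S \<subseteq> Z}"

definition zirreducible :: "(mat36) set \<Rightarrow> bool" where
  "zirreducible Z \<longleftrightarrow> zclosed Z \<and> Z \<noteq> {} \<and>
     (\<forall>Z1 Z2. zclosed Z1 \<and> zclosed Z2 \<and> Z \<subseteq> Z1 \<union> Z2 \<longrightarrow> Z \<subseteq> Z1 \<or> Z \<subseteq> Z2)"

definition alg_dim :: "(mat36) set \<Rightarrow> enat" where
  "alg_dim S = (SUP l\<in>{l::nat. \<exists>Z::nat \<Rightarrow> (mat36) set.
       (\<forall>i\<le>l. zirreducible (Z i) \<and> Z i \<subseteq> zclosure S) \<and> (\<forall>i<l. Z i \<subset> Z (Suc i))}. enat l)"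

end

theory Submission
  imports Defs "HOL-Computational_Algebra.Polynomial"
begin

text \<open>
  For the diagonal quadrics \<open>\<Sum>\<^sub>m n\<^sub>k\<^sub>m x\<^sub>m\<^sup>2\<close> a point of \<open>X\<^bsub>[N]\<^esub>\<close> is an \<open>x \<noteq> 0\<close> with
  \<open>N (x\<^sub>1\<^sup>2, \<dots>, x\<^sub>6\<^sup>2) = 0\<close>, and a relation among the gradients at \<open>x\<close> is a \<open>c\<close> with
  \<open>(c\<^sup>T N)\<^sub>m x\<^sub>m = 0\<close> for all \<open>m\<close>. If every three columns of \<open>N\<close> are independent,
  the support of \<open>x\<close> has at least four elements, so \<open>c\<^sup>T N\<close> vanishes on three independent
  columns and \<open>c = 0\<close>: \<open>X\<^bsub>[N]\<^esub>\<close> is smooth. If only the columns \<open>i, j, k\<close> are dependent,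
  the same count shows that a singular point is supported exactly on \<open>{i, j, k}\<close>, that
  \<open>c\<close> is unique up to scaling with \<open>c\<^sup>T N\<close> vanishing exactly there, and the Hessian of
  \<open>\<Sum> c\<^sub>k q\<^sub>k\<close> on the tangent space, \<open>diag(c\<^sup>T N)\<close>, has radical the line through \<open>x\<close>.

  The bad locus lies in the finite union of the intersections \<open>{\<Delta>\<^sub>a = 0} \<inter> {\<Delta>\<^sub>b = 0}\<close>
  of distinct sorted triples, so an irreducible closed subset of it lies in one such
  intersection and is properly contained in the irreducible hypersurface \<open>{\<Delta>\<^sub>a = 0}\<close>,
  itself properly contained in \<open>M\<^sub>3\<^sub>,\<^sub>6\<close>: every chain in the bad locus extends by two.
\<close>

lemma Delta_expand: "Delta N p q r =
  N$1$p * N$2$q * N$3$r - N$1$p * N$2$r * N$3$q - N$1$q * N$2$p * N$3$r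
  + N$1$q * N$2$r * N$3$p + N$1$r * N$2$p * N$3$q - N$1$r * N$2$q * N$3$p"
  unfolding Delta_def det_3 by simp

lemma Delta_sort_triple:
  fixes p q r :: 6
  assumes "p \<noteq> q" "q \<noteq> r" "p \<noteq> r"
  obtains a b c where "a < b" "b < c" "{a,b,c} = {p,q,r}"
    "Delta N p q r = 0 \<longleftrightarrow> Delta N a b c = 0"
proof -
  have odd: "Delta N q p r = - Delta N p q r" "Delta N p r q = - Delta N p q r"
      "Delta N r q p = - Delta N p q r"
    and even: "Delta N q r p = Delta N p q r" "Delta N r p q = Delta N p q r"
    unfolding Delta_expand by algebra+
  consider "p<q" "q<r" | "p<r" "r<q" | "q<p" "p<r" | "q<r" "r<p" | "r<p" "p<q" | "r<q" "q<p"
    using assms by (meson linorder_neqE)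
  then show thesis
  proof cases
    case 1 then show ?thesis using that by blast
  next
    case 2 then show ?thesis using that[of p r q] odd by (simp add: insert_commute)
  next
    case 3 then show ?thesis using that[of q p r] odd by (simp add: insert_commute)
  next
    case 4 then show ?thesis using that[of q r p] even by (simp add: insert_commute)
  next
    case 5 then show ?thesis using that[of r p q] even by (simp add: insert_commute)
  next
    case 6 then show ?thesis using that[of r q p] odd by (simp add: insert_commute)
  qed
qed

lemma Delta_ne_0_if_sorted_ne_0:
  fixes P :: "6 set \<Rightarrow> bool"
  assumes sorted: "\<And>a b c. a < b \<Longrightarrow> b < c \<Longrightarrow> P {a,b,c} \<Longrightarrow> Delta N a b c \<noteq> 0"
    and "p \<noteq> q" "q \<noteq> r" "p \<noteq> r" "P {p,q,r}"
  shows "Delta N p q r \<noteq> 0"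
  using Delta_sort_triple[OF assms(2-4)] sorted assms(5) by metis

lemma Delta_ne_0_T_o:
  assumes "N \<in> T_o" "p \<noteq> q" "q \<noteq> r" "p \<noteq> r"
  shows "Delta N p q r \<noteq> 0"
  by (rule Delta_ne_0_if_sorted_ne_0[where P = "\<lambda>_. True"]) (use assms in \<open>auto simp: T_o_def\<close>)

lemma Delta_ne_0_T_o_ijk:
  assumes "N \<in> T_o_ijk i j k" "i < j" "j < k" "p \<noteq> q" "q \<noteq> r" "p \<noteq> r" "{p,q,r} \<noteq> {i,j,k}"
  shows "Delta N p q r \<noteq> 0"
  by (rule Delta_ne_0_if_sorted_ne_0[where P = "\<lambda>S. S \<noteq> {i,j,k}"])
    (use assms in \<open>auto simp: T_o_ijk_def\<close>)

lemma vec_eq_0_if_orthogonal_to_columns: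
  assumes "Delta N p q r \<noteq> 0" and "(c v* N)$p = 0" "(c v* N)$q = 0" "(c v* N)$r = 0"
  shows "c = 0"
proof -
  have e: "c$1 * N$1$s + c$2 * N$2$s + c$3 * N$3$s = 0" if "(c v* N)$s = 0" for s
    using that by (simp add: vector_matrix_mult_def sum_3)
  have "c$1 * Delta N p q r = 0" "c$2 * Delta N p q r = 0" "c$3 * Delta N p q r = 0"
    unfolding Delta_expand using e[OF assms(2)] e[OF assms(3)] e[OF assms(4)] by algebra+
  then show ?thesis using assms(1) by (simp add: vec_eq_iff forall_3)
qed

lemma rank3_if_Delta_ne_0: "Delta N p q r \<noteq> 0 \<Longrightarrow> rank3 N"
  unfolding rank3_def
  by (auto intro: vec_eq_0_if_orthogonal_to_columns simp: vector_matrix_mult_def)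

lemma relation_supported_on_triple_eq_0:
  assumes "Delta N p q r \<noteq> 0" "p \<noteq> q" "q \<noteq> r" "p \<noteq> r"
    and rel: "N *v y = 0" and supp: "\<And>m. m \<notin> {p,q,r} \<Longrightarrow> y$m = 0"
  shows "y$p = 0" "y$q = 0" "y$r = 0"
proof -
  have "(\<Sum>m\<in>UNIV. N$k$m * y$m) = (\<Sum>m\<in>{p,q,r}. N$k$m * y$m)" for k
    by (rule sum.mono_neutral_right) (use supp in auto)
  then have e: "N$k$p * y$p + N$k$q * y$q + N$k$r * y$r = 0" for k
    using rel assms(2-4) by (auto simp: vec_eq_iff matrix_vector_mult_def add.assoc)
  have "y$p * Delta N p q r = 0" "y$q * Delta N p q r = 0" "y$r * Delta N p q r = 0"
    unfolding Delta_expand using e[of 1] e[of 2] e[of 3] by algebra+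
  then show "y$p = 0" "y$q = 0" "y$r = 0" using assms(1) by simp_all
qed

lemma exists_not_in_triple: "\<exists>r::6. r \<notin> {i,j,k}"
proof (rule ccontr)
  assume "\<not> ?thesis"
  then have "card (UNIV::6 set) \<le> card {i,j,k}" by (intro card_mono) auto
  also have "\<dots> \<le> 3" by (simp add: card_insert_if)
  finally show False by simp
qed

lemma cone_pts_QN: "x \<in> cone_pts (QN N) \<longleftrightarrow> x \<noteq> 0 \<and> N *v (\<chi> m. (x$m)^2) = 0"
proof -
  have "qf (QN N k) x = (N *v (\<chi> m. (x$m)^2))$k" for k
  proof -
    have "(\<Sum>j\<in>UNIV. QN N k $ m $ j * x$m * x$j) = N$k$m * (x$m)^2" for m
      by (simp add: QN_def power2_eq_square if_distrib[of "\<lambda>z. z * _"] cong: if_cong)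
    then show ?thesis by (simp add: qf_def matrix_vector_mult_def)
  qed
  then show ?thesis by (auto simp: cone_pts_def vec_eq_iff)
qed

lemma grad_QN: "grad (QN N k) x $ m = 2 * N$k$m * x$m"
proof -
  have "(\<Sum>j\<in>UNIV. (QN N k $ m $ j + QN N k $ j $ m) * x$j)
      = (\<Sum>j\<in>UNIV. if j = m then 2 * N$k$m * x$m else 0)"
    by (rule sum.cong) (auto simp: QN_def)
  then show ?thesis by (simp add: grad_def)
qed

lemma jac_rel_QN: "c \<in> jac_rel (QN N) x \<longleftrightarrow> (\<forall>m. (c v* N)$m * x$m = 0)"
proof -
  have "(\<Sum>k\<in>UNIV. c$k * grad (QN N k) x $ m) = 2 * ((c v* N)$m * x$m)" for m
    by (simp add: grad_QN vector_matrix_mult_def sum_distrib_left sum_distrib_right algebra_simps)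
  then show ?thesis by (simp add: jac_rel_def)
qed

lemma cone_point_eq_0_if_support_in_triple:
  assumes "Delta N p q r \<noteq> 0" "p \<noteq> q" "q \<noteq> r" "p \<noteq> r"
    and "N *v (\<chi> m. (x$m)^2) = 0" and "\<And>m. m \<notin> {p,q,r} \<Longrightarrow> x$m = 0"
  shows "x = 0"
  using relation_supported_on_triple_eq_0[OF assms(1-5)] assms(6)
  by (simp add: vec_eq_iff) metis

lemma cone_point_support_beyond:
  assumes cone: "N *v (\<chi> m. (x$m)^2) = 0" and xi: "x$i \<noteq> 0"
    and indep: "\<And>p q. p \<noteq> i \<Longrightarrow> q \<noteq> i \<Longrightarrow> p \<noteq> q \<Longrightarrow> Delta N i p q \<noteq> 0"
  obtains p q where "p \<noteq> i" "q \<noteq> i" "p \<noteq> q" "x$p \<noteq> 0" "x$q \<noteq> 0"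
proof -
  have "\<exists>p q. p \<noteq> i \<and> q \<noteq> i \<and> p \<noteq> q \<and> x$p \<noteq> 0 \<and> x$q \<noteq> 0"
  proof (rule ccontr)
    assume no_pair: "\<not> ?thesis"
    obtain j where j: "j \<noteq> i" "\<And>m. m \<notin> {i,j} \<Longrightarrow> x$m = 0"
    proof (cases "\<exists>j. j \<noteq> i \<and> x$j \<noteq> 0")
      case True
      then obtain j where "j \<noteq> i" "x$j \<noteq> 0" by blast
      with no_pair that show thesis by blast
    next
      case False
      obtain j :: 6 where "j \<notin> {i,i,i}" using exists_not_in_triple by blast
      with False that show thesis by auto
    qed
    obtain r where r: "r \<notin> {i,j,j}" using exists_not_in_triple by blast
    have "x = 0"
      by (rule cone_point_eq_0_if_support_in_triple[OF indep[of j r] _ _ _ cone]) (use j r in auto)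
    then show False using xi by simp
  qed
  then show thesis using that by blast
qed

theorem smooth_ci_QN_if_T_o:
  assumes N: "N \<in> T_o"
  shows "smooth_ci (QN N)"
  unfolding smooth_ci_def smooth_at_def
proof
  fix x assume "x \<in> cone_pts (QN N)"
  then have x0: "x \<noteq> 0" and cone: "N *v (\<chi> m. (x$m)^2) = 0" by (simp_all add: cone_pts_QN)
  obtain i where xi: "x$i \<noteq> 0" using x0 by (metis vec_eq_iff zero_index)
  have "Delta N i p q \<noteq> 0" if "p \<noteq> i" "q \<noteq> i" "p \<noteq> q" for p q
    using Delta_ne_0_T_o[OF N] that by metis
  then obtain p q where pq: "p \<noteq> i" "q \<noteq> i" "p \<noteq> q" "x$p \<noteq> 0" "x$q \<noteq> 0"
    by (rule cone_point_support_beyond[OF cone xi])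
  have "c = 0" if "c \<in> jac_rel (QN N) x" for c
    using that xi pq
    by (intro vec_eq_0_if_orthogonal_to_columns[OF Delta_ne_0_T_o[OF N, of i p q]])
      (auto simp: jac_rel_QN)
  moreover have "0 \<in> jac_rel (QN N) x" by (simp add: jac_rel_QN)
  ultimately show "jac_rel (QN N) x = {0}" by blast
qed

lemma bqf_diagonal:
  assumes "\<And>a b. H$a$b = (if a = b then h a else 0)"
  shows "bqf H v w = 2 * (\<Sum>a\<in>UNIV. h a * v$a * w$a)"
proof -
  have "(\<Sum>b\<in>UNIV. H$a$b * (v$a * w$b + w$a * v$b))
      = (\<Sum>b\<in>UNIV. if b = a then 2 * (h a * v$a * w$a) else 0)" for a
    by (rule sum.cong) (auto simp: assms algebra_simps)
  then show ?thesis by (simp add: bqf_def sum_distrib_left)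
qed

lemma tangent_space_QN:
  "(\<forall>l. (\<Sum>m\<in>UNIV. grad (QN N l) x $ m * v$m) = 0) \<longleftrightarrow> N *v (\<chi> m. x$m * v$m) = 0"
proof -
  have "(\<Sum>m\<in>UNIV. grad (QN N l) x $ m * v$m) = 2 * (N *v (\<chi> m. x$m * v$m))$l" for l
    by (simp add: grad_QN matrix_vector_mult_def sum_distrib_left algebra_simps)
  then show ?thesis by (simp add: vec_eq_iff)
qed

lemma bqf_jac_rel_QN:
  "bqf (\<chi> a b. \<Sum>l\<in>UNIV. c$l * QN N l $ a $ b) v w = 2 * (\<Sum>m\<in>UNIV. (c v* N)$m * v$m * w$m)"
  by (rule bqf_diagonal) (simp add: QN_def vector_matrix_mult_def)

locale T_o_ijk_singular_point =
  fixes N :: mat36 and i j k :: 6 and x :: "complex^6" and c :: "complex^3"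
  assumes ijk: "i < j" "j < k" and N: "N \<in> T_o_ijk i j k"
    and cone: "N *v (\<chi> m. (x$m)^2) = 0" and x0: "x \<noteq> 0"
    and c: "c \<in> jac_rel (QN N) x" "c \<noteq> 0"
begin

lemma Delta_ne_0_other_triple:
  "p \<noteq> q \<Longrightarrow> q \<noteq> r \<Longrightarrow> p \<noteq> r \<Longrightarrow> {p,q,r} \<noteq> {i,j,k} \<Longrightarrow> Delta N p q r \<noteq> 0"
  using Delta_ne_0_T_o_ijk[OF N ijk] .

lemma jac_rel_vanishes_on_support: "(c v* N)$m * x$m = 0"
  using c(1) unfolding jac_rel_QN by blast

lemma support_eq_ijk: "x$m \<noteq> 0 \<longleftrightarrow> m \<in> {i,j,k}"
proof -
  have outside: "x$m = 0" if m: "m \<notin> {i,j,k}" for m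
  proof (rule ccontr)
    assume xm: "x$m \<noteq> 0"
    have m_triple: "{m,p,q} \<noteq> {i,j,k}" for p q
      using m by blast
    have "Delta N m p q \<noteq> 0" if "p \<noteq> m" "q \<noteq> m" "p \<noteq> q" for p q
      using that m_triple by (intro Delta_ne_0_other_triple) auto
    then obtain p q where pq: "p \<noteq> m" "q \<noteq> m" "p \<noteq> q" "x$p \<noteq> 0" "x$q \<noteq> 0"
      by (rule cone_point_support_beyond[OF cone xm])
    have "c = 0"
      using xm pq jac_rel_vanishes_on_support m_triple
      by (intro vec_eq_0_if_orthogonal_to_columns[OF Delta_ne_0_other_triple[of m p q]])
        (auto simp del: insert_commute)
    then show False using c(2) by simp
  qed
  have inside: "x$u \<noteq> 0" if u: "{i,j,k} = {u,v,w}" "u \<noteq> v" "v \<noteq> w" "u \<noteq> w" for u v w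
  proof
    assume xu: "x$u = 0"
    obtain r where "r \<notin> {i,j,k}" using exists_not_in_triple by blast
    then have r: "r \<notin> {u,v,w}" unfolding u(1) .
    have "x$m = 0" if "m \<notin> {r,v,w}" for m
      using that xu outside[of m] unfolding u(1) by (cases "m = u") auto
    moreover have "{r,v,w} \<noteq> {i,j,k}" using r unfolding u(1) by blast
    ultimately have "x = 0"
      using r u(3)
      by (intro cone_point_eq_0_if_support_in_triple[OF Delta_ne_0_other_triple[of r v w] _ _ _ cone])
        (auto simp del: insert_commute)
    then show False using x0 by simp
  qed
  have "x$i \<noteq> 0" "x$j \<noteq> 0" "x$k \<noteq> 0"
    using inside[of i j k] inside[of j i k] inside[of k i j] ijk by (simp_all add: insert_commute)
  then show ?thesis using outside by auto
qed

lemma Delta_ne_0_i_j_outside: "r \<notin> {i,j,k} \<Longrightarrow> Delta N i j r \<noteq> 0"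
proof -
  assume r: "r \<notin> {i,j,k}"
  then have "{i,j,r} \<noteq> {i,j,k}" by blast
  then show ?thesis using r ijk by (intro Delta_ne_0_other_triple) auto
qed

lemma jac_rel_zeros: "(c v* N)$m = 0 \<longleftrightarrow> m \<in> {i,j,k}"
proof
  assume "m \<in> {i,j,k}"
  then show "(c v* N)$m = 0" using jac_rel_vanishes_on_support[of m] support_eq_ijk[of m] by auto
next
  have hijk: "(c v* N)$i = 0" "(c v* N)$j = 0"
    using jac_rel_vanishes_on_support[of i] jac_rel_vanishes_on_support[of j]
      support_eq_ijk[of i] support_eq_ijk[of j] by simp_all
  assume hm: "(c v* N)$m = 0"
  show "m \<in> {i,j,k}"
  proof (rule ccontr)
    assume "m \<notin> {i,j,k}"
    then have "c = 0" by (rule vec_eq_0_if_orthogonal_to_columns[OF Delta_ne_0_i_j_outside hijk hm])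
    then show False using c(2) by simp
  qed
qed

lemma jac_rel_in_span: "d \<in> jac_rel (QN N) x \<Longrightarrow> \<exists>t. d = t *s c"
proof -
  assume d: "d \<in> jac_rel (QN N) x"
  obtain r where r: "r \<notin> {i,j,k}" using exists_not_in_triple by blast
  then have cr: "(c v* N)$r \<noteq> 0" using jac_rel_zeros by blast
  define t where "t = (d v* N)$r / (c v* N)$r"
  have e: "((d - t *s c) v* N)$m = (d v* N)$m - t * (c v* N)$m" for m
    by (simp add: vector_matrix_mult_def sum_subtractf sum_distrib_left algebra_simps)
  have "(d v* N)$m = 0" if "m \<in> {i,j,k}" for m
  proof -
    have "(d v* N)$m * x$m = 0" using d unfolding jac_rel_QN by blast
    moreover have "x$m \<noteq> 0" using that support_eq_ijk by blast
    ultimately show ?thesis by simp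
  qed
  moreover have "(c v* N)$i = 0" "(c v* N)$j = 0" using jac_rel_zeros by blast+
  ultimately have "d - t *s c = 0"
    using cr by (intro vec_eq_0_if_orthogonal_to_columns[OF Delta_ne_0_i_j_outside[OF r]])
      (simp_all add: e, simp add: t_def)
  then show ?thesis by auto
qed

lemma tangent_radical:
  assumes tangent: "N *v (\<chi> m. x$m * v$m) = 0"
    and radical: "\<And>w. N *v (\<chi> m. x$m * w$m) = 0 \<Longrightarrow> (\<Sum>m\<in>UNIV. (c v* N)$m * v$m * w$m) = 0"
  shows "\<exists>t. v = t *s x"
proof -
  have v_outside: "v$m = 0" if m: "m \<notin> {i,j,k}" for m
  proof -
    have "(\<chi> n. x$n * axis m 1 $ n) = 0"
      using support_eq_ijk[of m] m by (simp add: vec_eq_iff axis_def)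
    then have "(\<Sum>n\<in>UNIV. (c v* N)$n * v$n * axis m 1 $ n) = 0"
      using radical[of "axis m 1"] by simp
    then have "(c v* N)$m * v$m = 0"
      by (simp add: axis_def if_distrib[of "\<lambda>z. _ * z"] cong: if_cong)
    then show ?thesis using jac_rel_zeros[of m] m by simp
  qed
  define t where "t = v$k / x$k"
  define y where "y = (\<chi> m. x$m * (v$m - t * x$m))"
  have "N *v y = N *v (\<chi> m. x$m * v$m) - t *s (N *v (\<chi> m. (x$m)^2))"
    by (simp add: y_def vec_eq_iff matrix_vector_mult_def sum_subtractf sum_distrib_left
        power2_eq_square algebra_simps)
  then have rel: "N *v y = 0" using tangent cone by simp
  have xk: "x$k \<noteq> 0" using support_eq_ijk by simp
  obtain r where r: "r \<notin> {i,j,k}" using exists_not_in_triple by blast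
  have "y$m = 0" if "m \<notin> {i,j,r}" for m
    using that xk support_eq_ijk[of m] by (cases "m = k") (auto simp: y_def t_def)
  then have "y$i = 0" "y$j = 0"
    using relation_supported_on_triple_eq_0[OF Delta_ne_0_i_j_outside[OF r] _ _ _ rel] r ijk
    by auto
  then have "v$m = t * x$m" if "m \<in> {i,j,k}" for m
    using that xk support_eq_ijk[of m] by (auto simp: y_def t_def)
  then have "v$m = t * x$m" for m
    using v_outside support_eq_ijk[of m] by (cases "m \<in> {i,j,k}") auto
  then show ?thesis by (auto simp: vec_eq_iff)
qed

end

theorem node_at_QN_if_T_o_ijk:
  assumes ijk: "i < j" "j < k" and N: "N \<in> T_o_ijk i j k" and x: "x \<in> sing_pts (QN N)"
  shows "node_at (QN N) x"
proof -
  have xc: "x \<in> cone_pts (QN N)" using x by (simp add: sing_pts_def)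
  then have cone: "N *v (\<chi> m. (x$m)^2) = 0" and x0: "x \<noteq> 0" by (simp_all add: cone_pts_QN)
  have "jac_rel (QN N) x \<noteq> {0}" using x by (simp add: sing_pts_def smooth_at_def)
  moreover have "0 \<in> jac_rel (QN N) x" by (simp add: jac_rel_QN)
  ultimately obtain c where c: "c \<in> jac_rel (QN N) x" "c \<noteq> 0" by blast
  interpret T_o_ijk_singular_point N i j k x c
    using ijk N cone x0 c by unfold_locales
  show ?thesis
    unfolding node_at_def Let_def
  proof (intro conjI exI[of _ c] ballI impI)
    fix v assume "v \<in> {v. \<forall>l. (\<Sum>m\<in>UNIV. grad (QN N l) x $ m * v$m) = 0}"
      and "\<forall>w\<in>{v. \<forall>l. (\<Sum>m\<in>UNIV. grad (QN N l) x $ m * v$m) = 0}.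
        bqf (\<chi> a b. \<Sum>l\<in>UNIV. c$l * QN N l $ a $ b) v w = 0"
    then show "\<exists>t. v = t *s x"
      by (intro tangent_radical) (auto simp: tangent_space_QN bqf_jac_rel_QN)
  qed (use xc c jac_rel_in_span in auto)
qed

lemma poly_fun_diff: "f \<in> poly_fun \<Longrightarrow> g \<in> poly_fun \<Longrightarrow> (\<lambda>N. f N - g N) \<in> poly_fun"
proof -
  assume "f \<in> poly_fun" "g \<in> poly_fun"
  then have "(\<lambda>N. f N + (-1) * g N) \<in> poly_fun" by (intro pf_add pf_mult pf_const)
  then show ?thesis by simp
qed

lemma poly_fun_Delta: "(\<lambda>N. Delta N p q r) \<in> poly_fun"
  unfolding Delta_expand by (intro poly_fun_diff pf_add pf_mult pf_var)

lemma zclosed_zero_set: "f \<in> poly_fun \<Longrightarrow> zclosed {N. f N = 0}"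
  unfolding zclosed_def by (intro exI[of _ "{f}"]) auto

lemma zclosed_UNIV: "zclosed UNIV"
  unfolding zclosed_def by (intro exI[of _ "{}"]) auto

lemma zclosed_empty: "zclosed {}"
  unfolding zclosed_def by (intro exI[of _ "{\<lambda>_. 1}"]) (auto intro: pf_const)

lemma zclosed_singleton: "zclosed {P}"
proof -
  define F where "F = {(\<lambda>N. N$\<rho>$s - P$\<rho>$s) | \<rho> s. True}"
  have "F \<subseteq> poly_fun"
  proof
    fix f assume "f \<in> F"
    then obtain \<rho> s where "f = (\<lambda>N. N$\<rho>$s - P$\<rho>$s)" unfolding F_def by blast
    then show "f \<in> poly_fun" using poly_fun_diff[OF pf_var pf_const] by simp
  qed
  moreover have "N = P" if "\<forall>f\<in>F. f N = 0" for N
  proof -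
    have "(\<lambda>N. N$\<rho>$s - P$\<rho>$s) \<in> F" for \<rho> s unfolding F_def by blast
    then have "N$\<rho>$s - P$\<rho>$s = 0" for \<rho> s using bspec[OF that] by fastforce
    then show ?thesis by (simp add: vec_eq_iff)
  qed
  then have "{P} = {N. \<forall>f\<in>F. f N = 0}" by (auto simp: F_def)
  ultimately show ?thesis unfolding zclosed_def by blast
qed

lemma zclosed_Int:
  assumes "zclosed A" "zclosed B"
  shows "zclosed (A \<inter> B)"
proof -
  obtain F G where F: "F \<subseteq> poly_fun" "A = {N. \<forall>f\<in>F. f N = 0}"
    and G: "G \<subseteq> poly_fun" "B = {N. \<forall>g\<in>G. g N = 0}"
    using assms unfolding zclosed_def by blast
  have "A \<inter> B = {N. \<forall>f\<in>F \<union> G. f N = 0}" unfolding F(2) G(2) by blast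
  moreover have "F \<union> G \<subseteq> poly_fun" using F(1) G(1) by blast
  ultimately show ?thesis unfolding zclosed_def by (intro exI[of _ "F \<union> G"]) simp
qed

lemma zclosed_Un:
  assumes "zclosed A" "zclosed B"
  shows "zclosed (A \<union> B)"
proof -
  obtain F G where F: "F \<subseteq> poly_fun" "A = {N. \<forall>f\<in>F. f N = 0}"
    and G: "G \<subseteq> poly_fun" "B = {N. \<forall>g\<in>G. g N = 0}"
    using assms unfolding zclosed_def by blast
  define H where "H = (\<lambda>(f, g) N. f N * g N) ` (F \<times> G)"
  have "H \<subseteq> poly_fun"
    using F(1) G(1) by (auto simp: H_def intro!: pf_mult)
  moreover have "A \<union> B = {N. \<forall>h\<in>H. h N = 0}"
  proof (intro set_eqI iffI)
    fix N assume "N \<in> A \<union> B"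
    then show "N \<in> {N. \<forall>h\<in>H. h N = 0}" unfolding F(2) G(2) H_def by auto
  next
    fix N assume N: "N \<in> {N. \<forall>h\<in>H. h N = 0}"
    show "N \<in> A \<union> B"
    proof (rule ccontr)
      assume "N \<notin> A \<union> B"
      then obtain f g where fg: "f \<in> F" "f N \<noteq> 0" "g \<in> G" "g N \<noteq> 0"
        unfolding F(2) G(2) by blast
      then have "(\<lambda>N. f N * g N) \<in> H" unfolding H_def by force
      then show False using N fg by auto
    qed
  qed
  ultimately show ?thesis unfolding zclosed_def by (intro exI[of _ H]) simp
qed

lemma zclosed_UN: "finite I \<Longrightarrow> (\<And>i. i \<in> I \<Longrightarrow> zclosed (C i)) \<Longrightarrow> zclosed (\<Union>i\<in>I. C i)"
  by (induction I rule: finite_induct) (simp_all add: zclosed_empty zclosed_Un)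

lemma zirreducible_singleton: "zirreducible {P}"
  unfolding zirreducible_def using zclosed_singleton by auto

lemma zirreducible_subset_UN:
  assumes Z: "zirreducible Z" and "finite I" "\<And>i. i \<in> I \<Longrightarrow> zclosed (C i)"
    and "Z \<subseteq> (\<Union>i\<in>I. C i)"
  shows "\<exists>i\<in>I. Z \<subseteq> C i"
  using assms(2-4)
proof (induction I rule: finite_induct)
  case empty
  then show ?case using Z by (simp add: zirreducible_def)
next
  case (insert i I)
  then have "Z \<subseteq> C i \<or> Z \<subseteq> (\<Union>i\<in>I. C i)"
    using Z unfolding zirreducible_def by (metis UN_insert insertCI zclosed_UN)
  then show ?case using insert.IH insert.prems by blast
qed

lemma zclosure_upper: "S \<subseteq> zclosure S"
  unfolding zclosure_def by blast

lemma zclosure_least: "zclosed Z \<Longrightarrow> S \<subseteq> Z \<Longrightarrow> zclosure S \<subseteq> Z"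
  unfolding zclosure_def by blast

lemma zclosure_mono: "S \<subseteq> T \<Longrightarrow> zclosure S \<subseteq> zclosure T"
  unfolding zclosure_def by blast

text \<open>A polynomial curve through two points of a union of two closed sets, lying in neither
  one alone, would make a product of two nonzero polynomials vanish on all of \<open>\<complex>\<close>.\<close>

definition pcurve :: "(complex \<Rightarrow> mat36) \<Rightarrow> bool" where
  "pcurve \<gamma> \<longleftrightarrow> (\<forall>r s. \<exists>p. \<forall>t. \<gamma> t $ r $ s = poly p t)"

definition poly_curve_connected :: "mat36 set \<Rightarrow> bool" where
  "poly_curve_connected S \<longleftrightarrow>
     (\<forall>P1\<in>S. \<forall>P2\<in>S. \<exists>\<gamma>. pcurve \<gamma> \<and> \<gamma> 0 = P1 \<and> \<gamma> 1 = P2 \<and> range \<gamma> \<subseteq> S)"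

lemma poly_fun_along_pcurve:
  assumes "f \<in> poly_fun" "pcurve \<gamma>"
  shows "\<exists>p. \<forall>t. f (\<gamma> t) = poly p t"
  using assms(1)
proof induction
  case (pf_const c)
  show ?case by (intro exI[of _ "[:c:]"]) simp
next
  case (pf_var r s)
  show ?case using assms(2) unfolding pcurve_def by blast
next
  case (pf_add f g)
  then obtain p q where "\<forall>t. f (\<gamma> t) = poly p t" "\<forall>t. g (\<gamma> t) = poly q t" by blast
  then show ?case by (intro exI[of _ "p + q"]) simp
next
  case (pf_mult f g)
  then obtain p q where "\<forall>t. f (\<gamma> t) = poly p t" "\<forall>t. g (\<gamma> t) = poly q t" by blast
  then show ?case by (intro exI[of _ "p * q"]) simp
qed

lemma zirreducible_if_poly_curve_connected:
  assumes conn: "poly_curve_connected S" and "zclosed S" "S \<noteq> {}"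
  shows "zirreducible S"
  unfolding zirreducible_def
proof (intro conjI allI impI assms(2,3))
  fix Z1 Z2 assume "zclosed Z1 \<and> zclosed Z2 \<and> S \<subseteq> Z1 \<union> Z2"
  then obtain F1 F2 where F1: "F1 \<subseteq> poly_fun" "Z1 = {N. \<forall>f\<in>F1. f N = 0}"
    and F2: "F2 \<subseteq> poly_fun" "Z2 = {N. \<forall>f\<in>F2. f N = 0}" and cover: "S \<subseteq> Z1 \<union> Z2"
    unfolding zclosed_def by blast
  show "S \<subseteq> Z1 \<or> S \<subseteq> Z2"
  proof (rule ccontr)
    assume "\<not> ?thesis"
    then obtain P1 P2 where P: "P1 \<in> S" "P1 \<notin> Z1" "P2 \<in> S" "P2 \<notin> Z2" by blast
    obtain f1 f2 where f: "f1 \<in> F1" "f1 P1 \<noteq> 0" "f2 \<in> F2" "f2 P2 \<noteq> 0"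
      using P F1(2) F2(2) by blast
    obtain \<gamma> where \<gamma>: "pcurve \<gamma>" "\<gamma> 0 = P1" "\<gamma> 1 = P2" "range \<gamma> \<subseteq> S"
      using conn P unfolding poly_curve_connected_def by blast
    obtain p1 p2 where p: "\<forall>t. f1 (\<gamma> t) = poly p1 t" "\<forall>t. f2 (\<gamma> t) = poly p2 t"
      using poly_fun_along_pcurve[OF _ \<gamma>(1)] f F1(1) F2(1) by (meson subsetD)
    have "poly (p1 * p2) t = 0" for t
    proof -
      have "\<gamma> t \<in> Z1 \<union> Z2" using \<gamma>(4) cover by blast
      then show ?thesis using F1(2) F2(2) f p by auto
    qed
    then have "p1 * p2 = 0" using poly_all_0_iff_0 by blast
    moreover have "p1 \<noteq> 0" "p2 \<noteq> 0" using p f \<gamma>(2,3) by (metis poly_0)+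
    ultimately show False by simp
  qed
qed

lemma zirreducible_UNIV: "zirreducible (UNIV :: mat36 set)"
proof (rule zirreducible_if_poly_curve_connected[OF _ zclosed_UNIV])
  show "poly_curve_connected UNIV"
    unfolding poly_curve_connected_def
  proof (intro ballI)
    fix P1 P2 :: mat36
    define \<gamma> :: "complex \<Rightarrow> mat36" where "\<gamma> t = (\<chi> r s. P1$r$s + t * (P2$r$s - P1$r$s))" for t
    have "pcurve \<gamma>"
      unfolding pcurve_def \<gamma>_def
      by (intro allI, rule_tac x="[:P1$r$s, P2$r$s - P1$r$s:]" in exI) (simp add: algebra_simps)
    moreover have "\<gamma> 0 = P1" "\<gamma> 1 = P2" by (simp_all add: \<gamma>_def vec_eq_iff)
    ultimately show "\<exists>\<gamma>. pcurve \<gamma> \<and> \<gamma> 0 = P1 \<and> \<gamma> 1 = P2 \<and> range \<gamma> \<subseteq> UNIV" by blast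
  qed
qed simp

definition columns_rank_le_2 :: "mat36 \<Rightarrow> 6 set \<Rightarrow> bool" where
  "columns_rank_le_2 N S \<longleftrightarrow>
     (\<exists>u w :: complex^3. \<exists>a b :: 6 \<Rightarrow> complex. \<forall>s\<in>S. column s N = a s *s u + b s *s w)"

lemma Delta_eq_0_if_columns_rank_le_2:
  assumes "columns_rank_le_2 N {p,q,r}"
  shows "Delta N p q r = 0"
proof -
  obtain u w :: "complex^3" and a b where ab: "\<And>s. s \<in> {p,q,r} \<Longrightarrow> column s N = a s *s u + b s *s w"
    using assms unfolding columns_rank_le_2_def by blast
  have entry: "N$\<rho>$s = a s * u$\<rho> + b s * w$\<rho>" if "s \<in> {p,q,r}" for s \<rho>
    using arg_cong[OF ab[OF that], of "\<lambda>v. v$\<rho>"] by (simp add: column_def)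
  then have e: "N$\<rho>$p = a p * u$\<rho> + b p * w$\<rho>" "N$\<rho>$q = a q * u$\<rho> + b q * w$\<rho>"
    "N$\<rho>$r = a r * u$\<rho> + b r * w$\<rho>" for \<rho>
    by simp_all
  show ?thesis unfolding Delta_expand e by algebra
qed

lemma columns_rank_le_2_if_dependent:
  assumes rel: "a *s column p N + b *s column q N + c *s column r N = 0" and c: "c \<noteq> 0"
  shows "columns_rank_le_2 N {p,q,r}"
proof -
  have col_r: "column r N = (- a / c) *s column p N + (- b / c) *s column q N"
  unfolding vec_eq_iff
  proof
    fix \<rho>
    have "a * column p N $ \<rho> + b * column q N $ \<rho> + c * column r N $ \<rho> = 0"
      using arg_cong[OF rel, of "\<lambda>v. v$\<rho>"] by simp
    then have "c * column r N $ \<rho> = - a * column p N $ \<rho> - b * column q N $ \<rho>"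
      by algebra
    then show "column r N $ \<rho> = ((- a / c) *s column p N + (- b / c) *s column q N) $ \<rho>"
      using c by (simp add: field_simps)
  qed
  define a' where "a' s = (if s = r then - a / c else if s = p then 1 else 0)" for s
  define b' where "b' s = (if s = r then - b / c else if s = p then 0 else 1)" for s
  have "column s N = a' s *s column p N + b' s *s column q N" if "s \<in> {p,q,r}" for s
    using that col_r by (auto simp: a'_def b'_def)
  then show ?thesis unfolding columns_rank_le_2_def by blast
qed

lemma columns_rank_le_2_if_Delta_eq_0:
  assumes "Delta N p q r = 0"
  shows "columns_rank_le_2 N {p,q,r}"
proof -
  define M where "M = (\<chi> \<rho> s::3. N $ \<rho> $ (if s = 1 then p else if s = 2 then q else r))"
  have "\<not> invertible M"
    using assms by (simp add: M_def Delta_def invertible_det_nz)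
  then obtain x where x: "M *v x = 0" "x \<noteq> 0"
    using invertible_left_inverse matrix_left_invertible_ker by blast
  have rel: "x$1 *s column p N + x$2 *s column q N + x$3 *s column r N = 0"
    using x(1) by (simp add: vec_eq_iff M_def matrix_vector_mult_def column_def sum_3 algebra_simps)
  consider "x$3 \<noteq> 0" | "x$1 \<noteq> 0" | "x$2 \<noteq> 0"
    using x(2) by (auto simp: vec_eq_iff forall_3)
  then show ?thesis
  proof cases
    case 1
    then show ?thesis by (rule columns_rank_le_2_if_dependent[OF rel])
  next
    case 2
    have "x$2 *s column q N + x$3 *s column r N + x$1 *s column p N = 0"
      using rel by (simp add: algebra_simps)
    from columns_rank_le_2_if_dependent[OF this 2] show ?thesis by (simp add: insert_commute)
  next
    case 3
    have "x$3 *s column r N + x$1 *s column p N + x$2 *s column q N = 0"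
      using rel by (simp add: algebra_simps)
    from columns_rank_le_2_if_dependent[OF this 3] show ?thesis by (simp add: insert_commute)
  qed
qed

text \<open>Both factors of a rank \<open>\<le> 2\<close> factorisation are interpolated linearly, so the
  interpolating matrices stay on the hypersurface.\<close>

lemma poly_curve_connected_Delta_zero: "poly_curve_connected {N. Delta N p q r = 0}"
  unfolding poly_curve_connected_def
proof (intro ballI)
  fix P1 P2 assume "P1 \<in> {N. Delta N p q r = 0}" "P2 \<in> {N. Delta N p q r = 0}"
  then have "columns_rank_le_2 P1 {p,q,r}" "columns_rank_le_2 P2 {p,q,r}"
    by (simp_all add: columns_rank_le_2_if_Delta_eq_0)
  then obtain u1 w1 a1 b1 u2 w2 a2 b2 where
    f1: "\<And>s. s \<in> {p,q,r} \<Longrightarrow> column s P1 = a1 s *s u1 + b1 s *s w1" and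
    f2: "\<And>s. s \<in> {p,q,r} \<Longrightarrow> column s P2 = a2 s *s u2 + b2 s *s w2"
    unfolding columns_rank_le_2_def by blast
  define a where "a s t = a1 s + t * (a2 s - a1 s)" for s t
  define b where "b s t = b1 s + t * (b2 s - b1 s)" for s t
  define u where "u t = u1 + t *s (u2 - u1)" for t
  define w where "w t = w1 + t *s (w2 - w1)" for t
  define \<gamma> where "\<gamma> t = (\<chi> \<rho> s. if s \<in> {p,q,r} then (a s t *s u t + b s t *s w t) $ \<rho>
      else P1$\<rho>$s + t * (P2$\<rho>$s - P1$\<rho>$s))" for t
  have \<gamma>_in: "\<gamma> t $ \<rho> $ s = a s t * u t $ \<rho> + b s t * w t $ \<rho>" if "s \<in> {p,q,r}" for t \<rho> s
    using that by (simp add: \<gamma>_def)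
  have \<gamma>_out: "\<gamma> t $ \<rho> $ s = P1$\<rho>$s + t * (P2$\<rho>$s - P1$\<rho>$s)" if "s \<notin> {p,q,r}" for t \<rho> s
    using that by (simp add: \<gamma>_def)
  have "pcurve \<gamma>"
    unfolding pcurve_def
  proof (intro allI)
    fix \<rho> s
    show "\<exists>pp. \<forall>t. \<gamma> t $ \<rho> $ s = poly pp t"
    proof (cases "s \<in> {p,q,r}")
      case True
      show ?thesis
        by (rule exI[of _ "[:a1 s, a2 s - a1 s:] * [:u1$\<rho>, u2$\<rho> - u1$\<rho>:]
            + [:b1 s, b2 s - b1 s:] * [:w1$\<rho>, w2$\<rho> - w1$\<rho>:]"])
          (simp add: \<gamma>_in[OF True] a_def b_def u_def w_def algebra_simps)
    next
      case False
      show ?thesis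
        by (rule exI[of _ "[:P1$\<rho>$s, P2$\<rho>$s - P1$\<rho>$s:]"])
          (simp add: \<gamma>_out[OF False] algebra_simps)
    qed
  qed
  moreover have "\<gamma> 0 $ \<rho> $ s = P1$\<rho>$s \<and> \<gamma> 1 $ \<rho> $ s = P2$\<rho>$s" for \<rho> s
  proof (cases "s \<in> {p,q,r}")
    case True
    have "P1$\<rho>$s = a1 s * u1$\<rho> + b1 s * w1$\<rho>" "P2$\<rho>$s = a2 s * u2$\<rho> + b2 s * w2$\<rho>"
      using arg_cong[OF f1[OF True], of "\<lambda>v. v$\<rho>"] arg_cong[OF f2[OF True], of "\<lambda>v. v$\<rho>"]
      by (simp_all add: column_def)
    then show ?thesis by (simp add: \<gamma>_in[OF True] a_def b_def u_def w_def)
  next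
    case False
    then show ?thesis by (simp add: \<gamma>_out)
  qed
  then have "\<gamma> 0 = P1" "\<gamma> 1 = P2" by (simp_all add: vec_eq_iff)
  moreover have "Delta (\<gamma> t) p q r = 0" for t
  proof (rule Delta_eq_0_if_columns_rank_le_2)
    have "\<forall>s\<in>{p,q,r}. column s (\<gamma> t) = a s t *s u t + b s t *s w t"
      unfolding vec_eq_iff column_def using \<gamma>_in by simp
    then show "columns_rank_le_2 (\<gamma> t) {p,q,r}"
      unfolding columns_rank_le_2_def
      by (intro exI[of _ "u t"] exI[of _ "w t"] exI[of _ "\<lambda>s. a s t"] exI[of _ "\<lambda>s. b s t"])
  qed
  ultimately show "\<exists>\<gamma>. pcurve \<gamma> \<and> \<gamma> 0 = P1 \<and> \<gamma> 1 = P2 \<and> range \<gamma> \<subseteq> {N. Delta N p q r = 0}"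
    by blast
qed

lemma zirreducible_Delta_zero: "zirreducible {N. Delta N p q r = 0}"
proof (rule zirreducible_if_poly_curve_connected[OF poly_curve_connected_Delta_zero])
  show "zclosed {N. Delta N p q r = 0}" by (rule zclosed_zero_set[OF poly_fun_Delta])
  have "Delta 0 p q r = 0" by (simp add: Delta_expand)
  then show "{N. Delta N p q r = 0} \<noteq> {}" by blast
qed

definition zchain :: "mat36 set \<Rightarrow> nat \<Rightarrow> (nat \<Rightarrow> mat36 set) \<Rightarrow> bool" where
  "zchain S l Z \<longleftrightarrow> (\<forall>i\<le>l. zirreducible (Z i) \<and> Z i \<subseteq> zclosure S) \<and> (\<forall>i<l. Z i \<subset> Z (Suc i))"

lemma alg_dim_zchain: "alg_dim S = (SUP l\<in>{l. \<exists>Z. zchain S l Z}. enat l)"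
  unfolding alg_dim_def zchain_def by simp

lemma SUP_enat_plus_2_le:
  assumes "A \<noteq> {}" and AB: "\<And>l. l \<in> A \<Longrightarrow> l + 2 \<in> B"
  shows "(SUP l\<in>A. enat l) + 2 \<le> (SUP l\<in>B. enat l)"
proof (cases "finite A")
  case True
  have "(SUP l\<in>A. enat l) + 2 \<le> enat (Max A) + 2"
    using True by (intro add_right_mono SUP_least) simp
  also have "\<dots> = enat (Max A + 2)" by (simp add: numeral_eq_enat)
  also have "\<dots> \<le> (SUP l\<in>B. enat l)" using AB Max_in[OF True assms(1)] by (intro SUP_upper)
  finally show ?thesis .
next
  case False
  have "enat n \<le> (SUP l\<in>B. enat l)" for n
  proof -
    obtain l where "l \<in> A" "n \<le> l" using False infinite_nat_iff_unbounded_le by blast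
    then have "enat n \<le> enat (l + 2)" "l + 2 \<in> B" using AB by auto
    then show ?thesis by (meson SUP_upper order_trans)
  qed
  then have "(SUP l\<in>B. enat l) = \<infinity>" by (metis enat_ord_simps(2) lessI not_le not_infinity_eq)
  then show ?thesis by simp
qed

lemma alg_dim_plus_2_le:
  assumes "S \<noteq> {}" "S \<subseteq> T"
    and extend: "\<And>Z. zirreducible Z \<Longrightarrow> Z \<subseteq> zclosure S \<Longrightarrow>
      \<exists>Y1 Y2. zirreducible Y1 \<and> zirreducible Y2 \<and> Z \<subset> Y1 \<and> Y1 \<subset> Y2 \<and> Y2 \<subseteq> zclosure T"
  shows "alg_dim S + 2 \<le> alg_dim T"
proof -
  obtain P where "P \<in> S" using assms(1) by blast
  then have "zchain S 0 (\<lambda>_. {P})"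
    using zirreducible_singleton zclosure_upper by (auto simp: zchain_def)
  then have nonempty: "{l. \<exists>Z. zchain S l Z} \<noteq> {}" by blast
  have "\<exists>Z'. zchain T (l + 2) Z'" if "zchain S l Z" for l Z
  proof -
    have Z: "\<forall>i\<le>l. zirreducible (Z i) \<and> Z i \<subseteq> zclosure T" "\<forall>i<l. Z i \<subset> Z (Suc i)"
      using that zclosure_mono[OF assms(2)] by (auto simp: zchain_def)
    have "zirreducible (Z l)" "Z l \<subseteq> zclosure S" using that by (simp_all add: zchain_def)
    from extend[OF this] obtain Y1 Y2 where
      Y: "zirreducible Y1" "zirreducible Y2" "Z l \<subset> Y1" "Y1 \<subset> Y2" "Y2 \<subseteq> zclosure T"
      by blast
    define Z' where "Z' n = (if n \<le> l then Z n else if n = Suc l then Y1 else Y2)" for n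
    have "zchain T (l + 2) Z'"
      unfolding zchain_def
    proof (intro conjI allI impI)
      fix n assume "n \<le> l + 2"
      then show "zirreducible (Z' n)" "Z' n \<subseteq> zclosure T"
        using Z Y by (auto simp: Z'_def dest: psubset_imp_subset)
    next
      fix n assume "n < l + 2"
      then show "Z' n \<subset> Z' (Suc n)"
        using Z(2) Y(3,4) by (auto simp: Z'_def not_less_eq_eq le_Suc_eq)
    qed
    then show ?thesis by blast
  qed
  then have "(SUP l\<in>{l. \<exists>Z. zchain S l Z}. enat l) + 2 \<le> (SUP l\<in>{l. \<exists>Z. zchain T l Z}. enat l)"
    by (intro SUP_enat_plus_2_le[OF nonempty]) blast
  then show ?thesis unfolding alg_dim_zchain .
qed

definition coord_mat :: "6 \<Rightarrow> 6 \<Rightarrow> 6 \<Rightarrow> mat36" where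
  "coord_mat a b c = (\<chi> \<rho> s. if (\<rho> = 1 \<and> s = a) \<or> (\<rho> = 2 \<and> s = b) \<or> (\<rho> = 3 \<and> s = c) then 1 else 0)"

lemma Delta_coord_mat: "a \<noteq> b \<Longrightarrow> b \<noteq> c \<Longrightarrow> a \<noteq> c \<Longrightarrow> Delta (coord_mat a b c) a b c = 1"
  unfolding Delta_expand coord_mat_def by simp

lemma Delta_eq_0_if_zero_column:
  assumes "column s N = 0" "s \<in> {p,q,r}"
  shows "Delta N p q r = 0"
proof -
  have zero: "N$\<rho>$s = 0" for \<rho>
    using arg_cong[OF assms(1), of "\<lambda>v. v$\<rho>"] by (simp add: column_def)
  from assms(2) consider "s = p" | "s = q" | "s = r" by blast
  then show ?thesis
  proof cases
    case 1 then show ?thesis using zero by (simp add: Delta_expand)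
  next
    case 2 then show ?thesis using zero by (simp add: Delta_expand)
  next
    case 3 then show ?thesis using zero by (simp add: Delta_expand)
  qed
qed

lemma Delta_coord_mat_eq_0: "s \<in> {p,q,r} \<Longrightarrow> s \<notin> {a,b,c} \<Longrightarrow> Delta (coord_mat a b c) p q r = 0"
  by (rule Delta_eq_0_if_zero_column) (auto simp: coord_mat_def column_def vec_eq_iff)

definition sorted_triples :: "(6 \<times> 6 \<times> 6) set" where
  "sorted_triples = {(i, j, k). i < j \<and> j < k}"

fun Delta_locus :: "6 \<times> 6 \<times> 6 \<Rightarrow> mat36 set" where
  "Delta_locus (i, j, k) = {N. Delta N i j k = 0}"

lemma zclosed_Delta_locus: "zclosed (Delta_locus a)"
  by (cases a) (simp add: zclosed_zero_set poly_fun_Delta)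

lemma zirreducible_Delta_locus: "zirreducible (Delta_locus a)"
  by (cases a) (simp add: zirreducible_Delta_zero)

lemma Delta_locus_ne_UNIV:
  assumes "a \<in> sorted_triples"
  shows "Delta_locus a \<noteq> UNIV"
proof -
  obtain i j k where "a = (i, j, k)" "i < j" "j < k" using assms unfolding sorted_triples_def by auto
  then have "coord_mat i j k \<notin> Delta_locus a" by (simp add: Delta_coord_mat)
  then show ?thesis by blast
qed

lemma Delta_locus_not_subset:
  assumes "a \<in> sorted_triples" "b \<in> sorted_triples" "a \<noteq> b"
  obtains N where "N \<in> Delta_locus a" "N \<notin> Delta_locus b"
proof -
  obtain i j k i' j' k' where a: "a = (i, j, k)" "i < j" "j < k" and b: "b = (i', j', k')" "i' < j'" "j' < k'"
    using assms(1,2) unfolding sorted_triples_def by auto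
  have "\<not> {i,j,k} \<subseteq> {i',j',k'}"
    using a b assms(3) by auto
  then obtain s where "s \<in> {i,j,k}" "s \<notin> {i',j',k'}" by blast
  then have "coord_mat i' j' k' \<in> Delta_locus a" "coord_mat i' j' k' \<notin> Delta_locus b"
    using a b by (simp_all add: Delta_coord_mat_eq_0 Delta_coord_mat)
  then show thesis by (rule that)
qed

lemma rank3_locus_minus_T_o_D_o_T_subset:
  "{N. rank3 N} - (T_o \<union> D_o_T) \<subseteq>
     (\<Union>(a, b)\<in>{(a, b). a \<in> sorted_triples \<and> b \<in> sorted_triples \<and> a \<noteq> b}. Delta_locus a \<inter> Delta_locus b)"
proof
  fix N assume "N \<in> {N. rank3 N} - (T_o \<union> D_o_T)"
  then have r: "rank3 N" and nT: "N \<notin> T_o" and nD: "N \<notin> D_o_T" by auto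
  obtain i j k where ijk: "i < j" "j < k" "Delta N i j k = 0" using r nT unfolding T_o_def by auto
  have "N \<notin> T_o_ijk i j k" using nD ijk unfolding D_o_T_def by blast
  then obtain l m n where lmn: "l < m" "m < n" "(l, m, n) \<noteq> (i, j, k)" "Delta N l m n = 0"
    using r ijk unfolding T_o_ijk_def by auto
  then show "N \<in> (\<Union>(a, b)\<in>{(a, b). a \<in> sorted_triples \<and> b \<in> sorted_triples \<and> a \<noteq> b}.
      Delta_locus a \<inter> Delta_locus b)"
    using ijk by (intro UN_I[of "((i, j, k), (l, m, n))"]) (auto simp: sorted_triples_def)
qed

lemma zclosure_rank3: "zclosure {N. rank3 N} = UNIV"
proof -
  have "Z = UNIV" if Z: "zclosed Z" "{N. rank3 N} \<subseteq> Z" for Z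
  proof -
    have "N \<in> Z \<union> Delta_locus (0, 1, 2)" for N
      using rank3_if_Delta_ne_0[of N 0 1 2] Z(2) by auto
    then have "UNIV \<subseteq> Z \<union> Delta_locus (0, 1, 2)" by blast
    then have "UNIV \<subseteq> Z \<or> UNIV \<subseteq> Delta_locus (0, 1, 2)"
      using zirreducible_UNIV Z(1) zclosed_Delta_locus unfolding zirreducible_def by blast
    moreover have "coord_mat 0 1 2 \<notin> Delta_locus (0, 1, 2)" by (simp add: Delta_coord_mat)
    ultimately show ?thesis by blast
  qed
  then show ?thesis unfolding zclosure_def by auto
qed

lemma numeral_order_6: "(0::6) < 1" "(1::6) < 3" "(1::6) < 4"
  by (simp_all add: less_bit0_def bit0.Rep_numeral bit0.Rep_0 bit0.Rep_1)

lemma coord_mat_in_bad_locus: "coord_mat 0 1 2 \<in> {N. rank3 N} - (T_o \<union> D_o_T)"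
proof -
  let ?E = "coord_mat 0 1 2"
  have z3: "Delta ?E 0 1 3 = 0" by (rule Delta_coord_mat_eq_0[of 3]) simp_all
  have z4: "Delta ?E 0 1 4 = 0" by (rule Delta_coord_mat_eq_0[of 4]) simp_all
  have "rank3 ?E" by (rule rank3_if_Delta_ne_0[of _ 0 1 2]) (simp add: Delta_coord_mat)
  moreover have "?E \<notin> T_o" using z3 numeral_order_6 unfolding T_o_def by auto
  moreover have "?E \<notin> T_o_ijk i j k" for i j k
  proof -
    have "(0::6, 1::6, 3::6) \<noteq> (i, j, k) \<or> (0::6, 1::6, 4::6) \<noteq> (i, j, k)" by auto
    then show ?thesis using z3 z4 numeral_order_6 unfolding T_o_ijk_def by blast
  qed
  ultimately show ?thesis unfolding D_o_T_def by blast
qed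

lemma alg_dim_bad_locus_plus_2_le:
  "alg_dim ({N. rank3 N} - (T_o \<union> D_o_T)) + 2 \<le> alg_dim {N. rank3 N}"
proof (rule alg_dim_plus_2_le)
  show "{N. rank3 N} - (T_o \<union> D_o_T) \<noteq> {}" using coord_mat_in_bad_locus by blast
  show "{N. rank3 N} - (T_o \<union> D_o_T) \<subseteq> {N. rank3 N}" by blast
  fix Z assume Z: "zirreducible Z" "Z \<subseteq> zclosure ({N. rank3 N} - (T_o \<union> D_o_T))"
  let ?I = "{(a, b). a \<in> sorted_triples \<and> b \<in> sorted_triples \<and> a \<noteq> b}"
  have closed: "zclosed ((\<lambda>(a, b). Delta_locus a \<inter> Delta_locus b) p)" for p
    unfolding case_prod_beta by (intro zclosed_Int zclosed_Delta_locus)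
  then have "zclosed (\<Union>(a, b)\<in>?I. Delta_locus a \<inter> Delta_locus b)"
    by (intro zclosed_UN) simp_all
  then have cover: "Z \<subseteq> (\<Union>(a, b)\<in>?I. Delta_locus a \<inter> Delta_locus b)"
    using Z(2) zclosure_least[OF _ rank3_locus_minus_T_o_D_o_T_subset] by blast
  have "finite ?I" by simp
  have "\<exists>p\<in>?I. Z \<subseteq> (\<lambda>(a, b). Delta_locus a \<inter> Delta_locus b) p"
    by (rule zirreducible_subset_UN[OF Z(1) \<open>finite ?I\<close> _ cover]) (rule closed)
  then obtain p where "p \<in> ?I" "Z \<subseteq> (\<lambda>(a, b). Delta_locus a \<inter> Delta_locus b) p" ..
  then have "fst p \<in> sorted_triples" "snd p \<in> sorted_triples" "fst p \<noteq> snd p"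
      "Z \<subseteq> Delta_locus (fst p)" "Z \<subseteq> Delta_locus (snd p)"
    by (auto simp: case_prod_beta simp del: Delta_locus.simps)
  then obtain a b where ab: "a \<in> sorted_triples" "b \<in> sorted_triples" "a \<noteq> b"
      and Zab: "Z \<subseteq> Delta_locus a" "Z \<subseteq> Delta_locus b"
    by blast
  obtain N where "N \<in> Delta_locus a" "N \<notin> Delta_locus b" by (rule Delta_locus_not_subset[OF ab])
  then have "Z \<subset> Delta_locus a" using Zab by blast
  moreover have "Delta_locus a \<subset> UNIV" using Delta_locus_ne_UNIV[OF ab(1)] by blast
  ultimately show "\<exists>Y1 Y2. zirreducible Y1 \<and> zirreducible Y2 \<and> Z \<subset> Y1 \<and> Y1 \<subset> Y2
      \<and> Y2 \<subseteq> zclosure {N. rank3 N}"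
    using zirreducible_Delta_locus zirreducible_UNIV zclosure_rank3 by blast
qed

theorem lemma3p3:
  shows "(\<forall>N\<in>T_o. smooth_ci (QN N))
    \<and> (\<forall>N\<in>D_o_T. \<forall>x\<in>sing_pts (QN N). node_at (QN N) x)
    \<and> alg_dim ({N. rank3 N} - (T_o \<union> D_o_T)) + 2 \<le> alg_dim {N. rank3 N}"
proof (intro conjI ballI)
  fix N assume "N \<in> T_o"
  then show "smooth_ci (QN N)" by (rule smooth_ci_QN_if_T_o)
next
  fix N x assume "N \<in> D_o_T" "x \<in> sing_pts (QN N)"
  then show "node_at (QN N) x" unfolding D_o_T_def by (blast intro: node_at_QN_if_T_o_ijk)
qed (rule alg_dim_bad_locus_plus_2_le)

end
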